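(* Let $\alpha\in(0,1]$. Suppose we are given, for a simple, complete, undirected graph $G$ on $n$ vertices with every edge weight in $\{0,1\}$, a Hamiltonian cycle of $G$ whose total weight is at least $\alpha$ times the maximum total weight of a Hamiltonian cycle of $G$ (an $\alpha$-approximation for $\mathsf{MaxTSP}(0,1)$). Then one can compute, in $O(n)$ time, a Hamiltonian path of $G$ whose total weight is at least $\alpha$ times the maximum total weight of a Hamiltonian path of $G$ (an $\alpha$-approximation for $\mathsf{PathMaxTSP}(0,1)$).
   Context: $\mathsf{MaxTSP}(0,1)$: given a simple complete undirected graph with all edge weights in $\{0,1\}$, find a Hamiltonian cycle (simple cycle through all vertices) of maximum total weight. $\mathsf{PathMaxTSP}(0,1)$: same input, find a Hamiltonian path (simple path through all vertices) of maximum total weight. *)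

theory Defs
  imports Complex_Main "HOL-Library.Landau_Symbols"
begin

definition complete_edges :: "'a set \<Rightarrow> 'a set set" where
  "complete_edges V = {{u, v} | u v. u \<in> V \<and> v \<in> V \<and> u \<noteq> v}"

definition zero_one_weighted :: "'a set \<Rightarrow> ('a set \<Rightarrow> nat) \<Rightarrow> bool" where
  "zero_one_weighted V w \<longleftrightarrow> (\<forall>e \<in> complete_edges V. w e \<in> {0, 1})"

text \<open>Paths and cycles are given by their vertex sequences; in a cycle the last vertex is
  joined back to the first one, which is not repeated in the list.\<close>

definition path_edges :: "'a list \<Rightarrow> 'a set list" where
  "path_edges p = map (\<lambda>(u, v). {u, v}) (zip p (tl p))"

definition cycle_edges :: "'a list \<Rightarrow> 'a set list" where
  "cycle_edges c = path_edges c @ [{last c, hd c}]"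

definition hamiltonian_path :: "'a set \<Rightarrow> 'a set set \<Rightarrow> 'a list \<Rightarrow> bool" where
  "hamiltonian_path V E p \<longleftrightarrow> distinct p \<and> set p = V \<and> set (path_edges p) \<subseteq> E"

definition hamiltonian_cycle :: "'a set \<Rightarrow> 'a set set \<Rightarrow> 'a list \<Rightarrow> bool" where
  "hamiltonian_cycle V E c \<longleftrightarrow>
     distinct c \<and> length c \<ge> 3 \<and> set c = V \<and> set (cycle_edges c) \<subseteq> E"

definition path_weight :: "('a set \<Rightarrow> nat) \<Rightarrow> 'a list \<Rightarrow> nat" where
  "path_weight w p = sum_list (map w (path_edges p))"

definition cycle_weight :: "('a set \<Rightarrow> nat) \<Rightarrow> 'a list \<Rightarrow> nat" where
  "cycle_weight w c = sum_list (map w (cycle_edges c))"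

definition max_tsp :: "'a set \<Rightarrow> ('a set \<Rightarrow> nat) \<Rightarrow> nat" where
  "max_tsp V w = Max {cycle_weight w c | c. hamiltonian_cycle V (complete_edges V) c}"

definition path_max_tsp :: "'a set \<Rightarrow> ('a set \<Rightarrow> nat) \<Rightarrow> nat" where
  "path_max_tsp V w = Max {path_weight w p | p. hamiltonian_path V (complete_edges V) p}"

definition max_tsp_approx :: "real \<Rightarrow> 'a set \<Rightarrow> ('a set \<Rightarrow> nat) \<Rightarrow> 'a list \<Rightarrow> bool" where
  "max_tsp_approx \<alpha> V w c \<longleftrightarrow>
     hamiltonian_cycle V (complete_edges V) c \<and>
     real (cycle_weight w c) \<ge> \<alpha> * real (max_tsp V w)"

definition path_max_tsp_approx :: "real \<Rightarrow> 'a set \<Rightarrow> ('a set \<Rightarrow> nat) \<Rightarrow> 'a list \<Rightarrow> bool" where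
  "path_max_tsp_approx \<alpha> V w p \<longleftrightarrow>
     hamiltonian_path V (complete_edges V) p \<and>
     real (path_weight w p) \<ge> \<alpha> * real (path_max_tsp V w)"


text \<open>Time is measured on a word RAM: each instruction costs one step, registers are addressed
  directly and memory cells through registers. A configuration consists of the program counter,
  the registers and the memory.\<close>

datatype instr =
    Const nat nat
  | Copy nat nat
  | Add nat nat nat
  | Sub nat nat nat
  | Mul nat nat nat
  | Load nat nat
  | Store nat nat
  | Jump nat
  | JumpIfZero nat nat
  | Halt

type_synonym config = "nat \<times> (nat \<Rightarrow> nat) \<times> (nat \<Rightarrow> nat)"

fun exec_instr :: "instr \<Rightarrow> config \<Rightarrow> config" where
  "exec_instr (Const d k) (pc, r, m) = (Suc pc, r(d := k), m)"
| "exec_instr (Copy d a) (pc, r, m) = (Suc pc, r(d := r a), m)"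
| "exec_instr (Add d a b) (pc, r, m) = (Suc pc, r(d := r a + r b), m)"
| "exec_instr (Sub d a b) (pc, r, m) = (Suc pc, r(d := r a - r b), m)"
| "exec_instr (Mul d a b) (pc, r, m) = (Suc pc, r(d := r a * r b), m)"
| "exec_instr (Load d a) (pc, r, m) = (Suc pc, r(d := m (r a)), m)"
| "exec_instr (Store a s) (pc, r, m) = (Suc pc, r, m(r a := r s))"
| "exec_instr (Jump l) (pc, r, m) = (l, r, m)"
| "exec_instr (JumpIfZero a l) (pc, r, m) = (if r a = 0 then l else Suc pc, r, m)"
| "exec_instr Halt (pc, r, m) = (pc, r, m)"

fun fits_words :: "nat \<Rightarrow> config \<Rightarrow> bool" where
  "fits_words B (pc, r, m) \<longleftrightarrow> (\<forall>i. r i < B) \<and> (\<forall>a. m a < B)"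

fun halted :: "instr list \<Rightarrow> config \<Rightarrow> bool" where
  "halted P (pc, r, m) \<longleftrightarrow> pc < length P \<and> P ! pc = Halt"

text \<open>A word holds a value below \<open>B\<close>. The machine gets stuck, without having halted, on an
  overflow and when the program counter leaves the program.\<close>

inductive ram_step :: "instr list \<Rightarrow> nat \<Rightarrow> config \<Rightarrow> config \<Rightarrow> bool" for P B where
  "\<lbrakk>pc < length P; P ! pc \<noteq> Halt; s' = exec_instr (P ! pc) (pc, r, m); fits_words B s'\<rbrakk>
   \<Longrightarrow> ram_step P B (pc, r, m) s'"

definition ram_init :: "nat list \<Rightarrow> config" where
  "ram_init xs = (0, \<lambda>_. 0, \<lambda>a. if a < length xs then xs ! a else 0)"

text \<open>The input occupies the memory cells from address 0 on, and so does the output.\<close>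

definition ram_computes :: "instr list \<Rightarrow> nat \<Rightarrow> nat \<Rightarrow> nat list \<Rightarrow> nat list \<Rightarrow> bool" where
  "ram_computes P B t xs ys \<longleftrightarrow>
     (\<exists>k pc r m. k \<le> t \<and> (ram_step P B ^^ k) (ram_init xs) (pc, r, m) \<and>
        halted P (pc, r, m) \<and> (\<forall>i < length ys. m i = ys ! i))"

text \<open>An instance is encoded as the number of vertices, the weighted adjacency matrix row by row
  (with zeros on the diagonal, where there is no edge), and the vertex sequence of the cycle.\<close>

definition encode_instance :: "nat \<Rightarrow> (nat set \<Rightarrow> nat) \<Rightarrow> nat list \<Rightarrow> nat list" where
  "encode_instance n w c =
     n # concat (map (\<lambda>u. map (\<lambda>v. if u = v then 0 else w {u, v}) [0..<n]) [0..<n]) @ c"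

end

theory Submission
  imports Defs
begin

text \<open>Cut the cycle along an edge of weight 0 if there is one. The resulting path is as heavy as the
  cycle, and a maximum path is no heavier than a maximum cycle since it can be closed up. If all
  edges of the cycle have weight 1, cutting it anywhere leaves a path of the largest conceivable
  weight \<open>n - 1\<close>. One scan of the cycle finds the edge, and one further pass writes out the cycle
  rotated to start behind it.\<close>

section \<open>Hamiltonian paths and cycles\<close>

lemma path_edges_Nil [simp]: "path_edges [] = []"
  and path_edges_single [simp]: "path_edges [x] = []"
  and path_edges_Cons_Cons [simp]: "path_edges (x # y # ys) = {x, y} # path_edges (y # ys)"
  by (simp_all add: path_edges_def)

lemma path_edges_snoc: "xs \<noteq> [] \<Longrightarrow> path_edges (xs @ [x]) = path_edges xs @ [{last xs, x}]"
  by (induction xs rule: induct_list012) auto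

lemma length_path_edges [simp]: "length (path_edges p) = length p - 1"
  by (simp add: path_edges_def)

lemma nth_path_edges: "Suc i < length p \<Longrightarrow> path_edges p ! i = {p ! i, p ! Suc i}"
  by (simp add: path_edges_def nth_tl)

lemma cycle_weight_eq: "cycle_weight w c = path_weight w c + w {last c, hd c}"
  by (simp add: cycle_weight_def path_weight_def cycle_edges_def)

lemma cycle_weight_rotate1: "cycle_weight w (rotate1 c) = cycle_weight w c"
proof (cases c)
  case (Cons x xs)
  then show ?thesis
    using path_edges_snoc[of xs x]
    by (cases xs) (simp_all add: cycle_weight_def cycle_edges_def)
qed simp

lemma cycle_weight_rotate: "cycle_weight w (rotate k c) = cycle_weight w c"
  by (induction k) (simp_all add: cycle_weight_rotate1)

lemma path_edges_subset_complete:
  "distinct p \<Longrightarrow> set (path_edges p) \<subseteq> complete_edges (set p)"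
proof (induction p rule: induct_list012)
  case (3 x y zs)
  then show ?case by (force simp: complete_edges_def)
qed simp_all

lemma hamiltonian_path_complete:
  "hamiltonian_path V (complete_edges V) p \<longleftrightarrow> distinct p \<and> set p = V"
  using path_edges_subset_complete by (auto simp: hamiltonian_path_def)

text \<open>In the complete graph only the closing edge needs an argument: a distinct list with at
  least 3 entries has different ends, so that edge is not a loop.\<close>

lemma hamiltonian_cycle_complete:
  "hamiltonian_cycle V (complete_edges V) c \<longleftrightarrow> distinct c \<and> length c \<ge> 3 \<and> set c = V"
proof -
  have "{last c, hd c} \<in> complete_edges (set c)" if "distinct c" "length c \<ge> 3"
  proof -
    have "c \<noteq> []" using that by auto
    then have "last c \<noteq> hd c"
      using that nth_eq_iff_index_eq[of c "length c - 1" 0]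
      by (simp add: last_conv_nth hd_conv_nth)
    with \<open>c \<noteq> []\<close> show ?thesis
      unfolding complete_edges_def by (auto intro!: exI conjI)
  qed
  then show ?thesis
    using path_edges_subset_complete[of c]
    by (auto simp: hamiltonian_cycle_def cycle_edges_def)
qed

lemma finite_distinct_lists: "finite V \<Longrightarrow> finite {p. distinct p \<and> set p = V}"
  by (rule finite_subset[OF _ finite_subset_distinct[of V]]) auto

section \<open>Bounds on the two optimal values\<close>

lemma path_max_tsp_attained:
  assumes "finite V"
  obtains p where "distinct p" "set p = V" "path_max_tsp V w = path_weight w p"
proof -
  have "path_max_tsp V w \<in> {path_weight w p | p. distinct p \<and> set p = V}"
    unfolding path_max_tsp_def hamiltonian_path_complete
    using assms finite_distinct_lists[of V] finite_distinct_list[of V] by (intro Max_in) auto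
  then show ?thesis using that by auto
qed

lemma cycle_weight_le_max_tsp:
  assumes "finite V" "distinct c" "length c \<ge> 3" "set c = V"
  shows "cycle_weight w c \<le> max_tsp V w"
proof -
  have "finite {c. distinct c \<and> length c \<ge> 3 \<and> set c = V}"
    using finite_distinct_lists[OF assms(1)] by (rule rev_finite_subset) auto
  then show ?thesis
    unfolding max_tsp_def hamiltonian_cycle_complete using assms by (intro Max_ge) auto
qed

text \<open>Weights are natural numbers, so closing an optimal path cannot lower its weight;
  \<open>card V \<ge> 3\<close> makes the closed path a Hamiltonian cycle.\<close>

lemma path_max_tsp_le_max_tsp:
  assumes "finite V" "card V \<ge> 3"
  shows "path_max_tsp V w \<le> max_tsp V w"
proof -
  obtain p where p: "distinct p" "set p = V" "path_max_tsp V w = path_weight w p"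
    using path_max_tsp_attained[OF assms(1)] .
  have "path_weight w p \<le> cycle_weight w p" by (simp add: cycle_weight_eq)
  also have "\<dots> \<le> max_tsp V w"
    using p assms distinct_card[of p] by (intro cycle_weight_le_max_tsp) auto
  finally show ?thesis using p by simp
qed

lemma path_weight_le:
  assumes "zero_one_weighted V w" "distinct p" "set p = V"
  shows "path_weight w p \<le> card V - 1"
proof -
  have "path_weight w p \<le> sum_list (map (\<lambda>_. 1) (path_edges p))"
    unfolding path_weight_def
    using assms path_edges_subset_complete[of p]
    by (intro sum_list_mono) (fastforce simp: zero_one_weighted_def)
  then show ?thesis using assms distinct_card[of p] by (simp add: sum_list_triv)
qed

lemma path_weight_all_ones:
  assumes "\<And>i. Suc i < length p \<Longrightarrow> w {p ! i, p ! Suc i} = 1"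
  shows "path_weight w p = length p - 1"
proof -
  have "map w (path_edges p) = replicate (length p - 1) 1"
    using assms by (intro nth_equalityI) (auto simp: nth_path_edges less_diff_conv)
  then show ?thesis by (simp add: path_weight_def sum_list_replicate)
qed

text \<open>Used to identify the edge removed by the cut: for \<open>k < length c\<close> the
  rotated list ends in \<open>c ! (k - 1)\<close> and starts with \<open>c ! k\<close>.\<close>

lemma last_rotate_conv_nth:
  assumes "0 < k" "k \<le> length c"
  shows "last (rotate k c) = c ! (k - 1)"
proof -
  have "last (rotate k c) = c ! ((k + (length c - 1)) mod length c)"
    using assms nth_rotate[of "length c - 1" c k] by (cases "c = []") (auto simp: last_conv_nth)
  also have "k + (length c - 1) = (k - 1) + length c" using assms by simp
  also have "\<dots> mod length c = k - 1"
    using assms by (simp only: mod_add_self2) simp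
  finally show ?thesis .
qed

text \<open>The hypotheses describe the first position \<open>k\<close> at which the cycle can be cut along an edge
  of weight 0, where \<open>k = length c\<close> stands for cutting the closing edge.\<close>

lemma path_max_tsp_approx_rotate:
  assumes alpha: "0 < \<alpha>" "\<alpha> \<le> 1"
    and w: "zero_one_weighted V w" and c: "max_tsp_approx \<alpha> V w c"
    and k: "0 < k" "k \<le> length c"
    and zero: "k < length c \<Longrightarrow> w {c ! (k - 1), c ! k} = 0"
    and ones: "\<And>i. 0 < i \<Longrightarrow> i < k \<Longrightarrow> w {c ! (i - 1), c ! i} \<noteq> 0"
  shows "path_max_tsp_approx \<alpha> V w (rotate k c)"
proof -
  have dc: "distinct c" "length c \<ge> 3" "set c = V"
    and apx: "\<alpha> * real (max_tsp V w) \<le> real (cycle_weight w c)"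
    using c by (auto simp: max_tsp_approx_def hamiltonian_cycle_complete)
  have fin: "finite V" and card: "card V = length c"
    using dc distinct_card by auto
  have le: "\<alpha> * real (path_max_tsp V w) \<le> real (cycle_weight w c)"
  proof -
    have "real (path_max_tsp V w) \<le> real (max_tsp V w)"
      using path_max_tsp_le_max_tsp[of V w] fin card dc by simp
    then show ?thesis
      using apx alpha mult_left_mono[of "real (path_max_tsp V w)" "real (max_tsp V w)" \<alpha>] by linarith
  qed
  \<comment> \<open>Rotation preserves the weight of the cycle, so the path loses exactly the edge
    that closes the rotated cycle.\<close>
  have split: "cycle_weight w c
      = path_weight w (rotate k c) + w {last (rotate k c), hd (rotate k c)}"
    by (metis cycle_weight_eq cycle_weight_rotate)
  have "\<alpha> * real (path_max_tsp V w) \<le> real (path_weight w (rotate k c))"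
  proof (cases "w {last (rotate k c), hd (rotate k c)} = 0")
    case True
    then show ?thesis using le split by simp
  next
    case False
    \<comment> \<open>A cut at \<open>k < length c\<close> removes an edge of weight 0. So here no
      such edge was found, all consecutive edges have weight 1, and the rotation is the
      identity.\<close>
    have "k = length c"
    proof (rule ccontr)
      assume "k \<noteq> length c"
      then have "k < length c" using k by simp
      then have "hd (rotate k c) = c ! k" using hd_rotate_conv_nth[of c k] by fastforce
      then show False using \<open>k < length c\<close> False zero last_rotate_conv_nth[OF k] by simp
    qed
    have "w {c ! i, c ! Suc i} = 1" if "Suc i < length c" for i
    proof -
      have "{c ! i, c ! Suc i} \<in> complete_edges V"
        using path_edges_subset_complete[OF dc(1)] that dc(3)
          nth_mem[of i "path_edges c"] nth_path_edges[OF that] by auto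
      then show ?thesis
        using w ones[of "Suc i"] that \<open>k = length c\<close> by (auto simp: zero_one_weighted_def)
    qed
    then have "path_weight w (rotate k c) = length c - 1"
      using \<open>k = length c\<close> path_weight_all_ones[of c w] by simp
    moreover obtain p where "distinct p" "set p = V" "path_max_tsp V w = path_weight w p"
      using path_max_tsp_attained[OF fin] .
    then have "path_max_tsp V w \<le> length c - 1"
      using path_weight_le[OF w, of p] card by simp
    ultimately show ?thesis
      using alpha mult_left_le_one_le[of "real (path_max_tsp V w)" \<alpha>] by linarith
  qed
  then show ?thesis
    using dc by (simp add: path_max_tsp_approx_def hamiltonian_path_complete)
qed

section \<open>Memory layout\<close>

lemma length_matrix_rows: "length (concat (map (\<lambda>u. map (f u) [0..<n]) [0..<k])) = k * n"
  by (induction k) auto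

text \<open>The number \<open>k\<close> of rows is kept apart from the row length \<open>n\<close>
  so that the induction can add rows of fixed length.\<close>

lemma nth_matrix_rows:
  "u < k \<Longrightarrow> v < n \<Longrightarrow>
   concat (map (\<lambda>u. map (f u) [0..<n]) [0..<k]) ! (u * n + v) = f u v"
proof (induction k)
  case (Suc k)
  show ?case
  proof (cases "u = k")
    case True
    then show ?thesis using Suc.prems by (simp add: nth_append length_matrix_rows)
  next
    case False
    then have "u < k" using Suc.prems by simp
    moreover have "u * n + v < k * n"
    proof -
      have "u * n + v < Suc u * n" using Suc.prems by simp
      also have "\<dots> \<le> k * n" using \<open>u < k\<close> by (intro mult_le_mono1) simp
      finally show ?thesis .
    qed
    ultimately show ?thesis
      using Suc.IH Suc.prems by (simp add: nth_append length_matrix_rows)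
  qed
qed simp

text \<open>The memory component of \<open>ram_init\<close> on the encoded instance.\<close>

definition instance_memory :: "nat \<Rightarrow> (nat set \<Rightarrow> nat) \<Rightarrow> nat list \<Rightarrow> nat \<Rightarrow> nat" where
  "instance_memory n w c a =
     (if a < length (encode_instance n w c) then encode_instance n w c ! a else 0)"

lemma instance_memory_0: "instance_memory n w c 0 = n"
  by (simp add: instance_memory_def encode_instance_def)

text \<open>The offset 1 comes from cell 0, which holds \<open>n\<close>;
  \<open>u \<noteq> v\<close> avoids the diagonal, where the encoding has 0 instead of a
  weight.\<close>

lemma instance_memory_matrix:
  assumes "u < n" "v < n" "u \<noteq> v"
  shows "instance_memory n w c (Suc (u * n + v)) = w {u, v}"
proof -
  have "u * n + v < Suc u * n" using assms by simp
  also have "\<dots> \<le> n * n" using assms by (intro mult_le_mono1) simp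
  finally show ?thesis
    using assms
    by (simp add: instance_memory_def encode_instance_def length_matrix_rows nth_append
          nth_matrix_rows)
qed

lemma instance_memory_cycle:
  "i < length c \<Longrightarrow> instance_memory n w c (Suc (n * n + i)) = c ! i"
  by (simp add: instance_memory_def encode_instance_def length_matrix_rows nth_append)

lemma instance_memory_le:
  assumes "zero_one_weighted {..<n} w" "set c \<subseteq> {..<n}"
  shows "instance_memory n w c a \<le> n"
proof -
  have "x \<le> n" if x: "x \<in> set (encode_instance n w c)" for x
  proof -
    have "w {u, v} \<le> n" if "u < n" "v < n" "u \<noteq> v" for u v
    proof -
      have "{u, v} \<in> complete_edges {..<n}"
        using that unfolding complete_edges_def by blast
      then have "w {u, v} \<in> {0, 1}"
        using assms(1) unfolding zero_one_weighted_def by blast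
      then show ?thesis using that by auto
    qed
    then show ?thesis
      using x assms(2) unfolding encode_instance_def by (auto split: if_splits)
  qed
  then show ?thesis by (auto simp: instance_memory_def)
qed

section \<open>Execution of the program\<close>

definition bounded_by :: "nat \<Rightarrow> (nat \<Rightarrow> nat) \<Rightarrow> bool" where
  "bounded_by B f \<longleftrightarrow> (\<forall>i. f i < B)"

text \<open>An instruction writes at most one register or cell, so its overflow check reduces to one
  comparison.\<close>

lemma bounded_by_fun_upd [simp]:
  "bounded_by B f \<Longrightarrow> bounded_by B (f(a := b)) \<longleftrightarrow> b < B"
  by (auto simp: bounded_by_def)

lemma ram_step_iff:
  "ram_step P B (pc, r, m) t \<longleftrightarrow>
     pc < length P \<and> P ! pc \<noteq> Halt \<and>
     (case exec_instr (P ! pc) (pc, r, m) of (pc', r', m') \<Rightarrow>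
        bounded_by B r' \<and> bounded_by B m' \<and> t = (pc', r', m'))"
  by (cases "exec_instr (P ! pc) (pc, r, m)") (auto simp: ram_step.simps bounded_by_def)

text \<open>Peeling off the first step lets the simplifier execute a run of literal length
  instruction by instruction; steps are deterministic, so the final configuration is computed on the
  way.\<close>

lemma relpowp_ram_step_numeral:
  "(ram_step P B ^^ numeral k) (pc, r, m) t \<longleftrightarrow>
     pc < length P \<and> P ! pc \<noteq> Halt \<and>
     (case exec_instr (P ! pc) (pc, r, m) of (pc', r', m') \<Rightarrow>
        bounded_by B r' \<and> bounded_by B m' \<and> (ram_step P B ^^ pred_numeral k) (pc', r', m') t)"
proof -
  have "(ram_step P B ^^ numeral k) (pc, r, m) t \<longleftrightarrow>
      (\<exists>u. ram_step P B (pc, r, m) u \<and> (ram_step P B ^^ pred_numeral k) u t)"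
    unfolding numeral_eq_Suc by (metis relpowp_Suc_D2 relpowp_Suc_I2)
  then show ?thesis
    by (cases "exec_instr (P ! pc) (pc, r, m)") (auto simp: ram_step_iff)
qed

text \<open>Register 0 is constantly 0, register 1 constantly 1; register 2 holds \<open>n\<close>, registers 3 and 4
  the addresses of the beginning and the end of the cycle, register 5 the current address in the
  cycle. Instructions 6 to 17 look for an edge of weight 0; instructions 19 to 29 copy the cycle from
  there on to the output, register 7 being the output address.\<close>

definition cut_program :: "instr list" where
  "cut_program =
    [Load 2 0, Const 1 1, Mul 3 2 2, Add 3 3 1, Add 4 3 2, Add 5 3 1,
     Sub 6 4 5, JumpIfZero 6 18, Sub 6 5 1, Load 6 6, Mul 6 6 2, Load 7 5, Add 6 6 7, Add 6 6 1,
     Load 6 6, JumpIfZero 6 18, Add 5 5 1, Jump 6,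
     Const 7 0,
     Sub 6 2 7, JumpIfZero 6 30, Sub 6 4 5, JumpIfZero 6 24, Jump 25, Copy 5 3,
     Load 6 5, Store 7 6, Add 7 7 1, Add 5 5 1, Jump 19,
     Halt]"

text \<open>Invariant shared by both loops; \<open>i\<close> is the position in the cycle. Registers
  6 and 7 are working space, constrained only by the word bound.\<close>

definition cut_registers :: "nat \<Rightarrow> nat \<Rightarrow> (nat \<Rightarrow> nat) \<Rightarrow> bool" where
  "cut_registers n i r \<longleftrightarrow> r 0 = 0 \<and> r 1 = 1 \<and> r 2 = n \<and> r 3 = Suc (n * n) \<and>
     r 4 = Suc (n * n) + n \<and> r 5 = Suc (n * n) + i \<and> bounded_by (n ^ 4) r"

lemmas run_simps =
  relpowp_ram_step_numeral ram_step_iff eq_OO cut_program_def cut_registers_def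

lemma relpowp_ram_step_trans:
  "(ram_step P B ^^ k) s t \<Longrightarrow> (ram_step P B ^^ l) t u \<Longrightarrow> (ram_step P B ^^ (k + l)) s u"
  by (auto simp: relpowp_add)

text \<open>The largest value the program forms is the address \<open>n * n + n + 1\<close> just
  past the cycle. The bound passes through \<open>3 * (n * n)\<close>, where
  \<open>3 \<le> n\<close> gives \<open>3 \<le> n * n\<close>.\<close>

lemma address_bound:
  assumes "3 \<le> (n::nat)" "a \<le> n * n + 2 * n + 2"
  shows "a < n ^ 4"
proof -
  have "n * 3 \<le> n * n" "3 * 3 \<le> n * n" using assms by (intro mult_le_mono; simp)+
  then have "a < n * n * 3" using assms by linarith
  also have "\<dots> \<le> n * n * (n * n)" using \<open>3 * 3 \<le> n * n\<close> by (intro mult_le_mono2) simp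
  finally show ?thesis by (simp add: power4_eq_xxxx)
qed

section \<open>Running time and output of the program on one instance\<close>

context
  fixes n :: nat and w :: "nat set \<Rightarrow> nat" and c :: "nat list" and m :: "nat \<Rightarrow> nat"
  assumes n: "3 \<le> n" and w: "zero_one_weighted {..<n} w"
    and c: "distinct c" "set c = {..<n}"
  defines "m \<equiv> instance_memory n w c"
begin

lemma length_cycle: "length c = n"
  using c distinct_card by fastforce

lemma nth_cycle_less: "i < n \<Longrightarrow> c ! i < n"
  using c length_cycle nth_mem by fastforce

lemma bounded_by_memory: "bounded_by (n ^ 4) m"
  unfolding bounded_by_def
proof
  fix a
  have "m a \<le> n" unfolding m_def using instance_memory_le[OF w] c by simp
  then show "m a < n ^ 4" by (intro address_bound n) simp
qed

text \<open>The scan starts at position 1 because at position \<open>i\<close> it inspects the edge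
  between positions \<open>i - 1\<close> and \<open>i\<close>.\<close>

lemma setup_run:
  "\<exists>r. (ram_step cut_program (n ^ 4) ^^ 6) (0, \<lambda>_. 0, m) (6, r, m) \<and> cut_registers n 1 r"
proof -
  have "bounded_by (n ^ 4) (\<lambda>_. 0)" using n by (simp add: bounded_by_def)
  then show ?thesis
    using bounded_by_memory n
    by (simp add: run_simps address_bound instance_memory_0 m_def)
qed

lemma scan_exit_end:
  assumes "cut_registers n n r"
  shows "\<exists>r'. (ram_step cut_program (n ^ 4) ^^ 2) (6, r, m) (18, r', m) \<and> cut_registers n n r'"
  using assms bounded_by_memory n
  by (simp add: run_simps address_bound)

text \<open>Instructions 6 to 15 read both endpoints and look up their matrix entry in 10 steps;
  continuing adds the increment and the jump back.\<close>

lemma scan_edge: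
  assumes r: "cut_registers n i r" and i: "0 < i" "i < n"
  shows "w {c ! (i - 1), c ! i} = 0 \<Longrightarrow>
      \<exists>r'. (ram_step cut_program (n ^ 4) ^^ 10) (6, r, m) (18, r', m) \<and> cut_registers n i r'"
    and "w {c ! (i - 1), c ! i} \<noteq> 0 \<Longrightarrow>
      \<exists>r'. (ram_step cut_program (n ^ 4) ^^ 12) (6, r, m) (6, r', m) \<and> cut_registers n (Suc i) r'"
proof -
  obtain j where j: "i = Suc j" using i by (cases i) auto
  have less: "c ! j < n" "c ! Suc j < n"
    using i j nth_cycle_less by auto
  \<comment> \<open>The entry looked up is off the diagonal, hence the weight of the edge.\<close>
  have "c ! j \<noteq> c ! Suc j"
    using c(1) i j length_cycle by (simp add: nth_eq_iff_index_eq)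
  then have mem: "m (Suc (n * n + j)) = c ! j" "m (Suc (Suc (n * n + j))) = c ! Suc j"
    "m (Suc (c ! j * n + c ! Suc j)) = w {c ! j, c ! Suc j}"
    using less i j length_cycle instance_memory_cycle[of j c n w]
      instance_memory_cycle[of "Suc j" c n w] instance_memory_matrix[of "c ! j" n "c ! Suc j" w c]
    by (simp_all add: m_def)
  \<comment> \<open>Every partial result of the address computation has to fit into a word.\<close>
  have "c ! j * n \<le> n * n" using less by simp
  then have "a < n ^ 4" if "a \<le> Suc (c ! j * n + c ! Suc j)" for a
    using less that by (intro address_bound n) linarith
  then have bounds: "c ! j * n < n ^ 4" "c ! j * n + c ! Suc j < n ^ 4"
    "Suc (c ! j * n + c ! Suc j) < n ^ 4" "c ! j < n ^ 4" "c ! Suc j < n ^ 4"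
    using less n address_bound by simp_all
  have "w {c ! j, c ! Suc j} < n ^ 4"
    using bounded_by_memory mem(3) unfolding bounded_by_def by metis
  note facts = this r bounded_by_memory n i mem bounds
  show "\<exists>r'. (ram_step cut_program (n ^ 4) ^^ 10) (6, r, m) (18, r', m) \<and> cut_registers n i r'"
    if "w {c ! (i - 1), c ! i} = 0"
    using that facts unfolding j
    by (simp add: run_simps address_bound)
  show "\<exists>r'. (ram_step cut_program (n ^ 4) ^^ 12) (6, r, m) (6, r', m) \<and> cut_registers n (Suc i) r'"
    if "w {c ! (i - 1), c ! i} \<noteq> 0"
    using that facts unfolding j
    by (simp add: run_simps address_bound)
qed

text \<open>Induction downwards from \<open>i = n\<close>, with 12 steps for each edge passed.
  Leaving takes 2 steps at the end and 10 at an edge of weight 0, where \<open>i < n\<close> leaves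
  room for them.\<close>

lemma scan_run:
  assumes "cut_registers n i r" "0 < i" "i \<le> n"
  shows "\<exists>t k r'. t \<le> 12 * (n - i) + 2 \<and> i \<le> k \<and> k \<le> n \<and>
    (k < n \<longrightarrow> w {c ! (k - 1), c ! k} = 0) \<and> (\<forall>l. i \<le> l \<and> l < k \<longrightarrow> w {c ! (l - 1), c ! l} \<noteq> 0) \<and>
    (ram_step cut_program (n ^ 4) ^^ t) (6, r, m) (18, r', m) \<and> cut_registers n k r'"
  using assms(3,1,2)
proof (induction i arbitrary: r rule: inc_induct)
  case base
  then show ?case
    using scan_exit_end by (intro exI[of _ 2] exI[of _ n]) auto
next
  case (step i)
  show ?case
  proof (cases "w {c ! (i - 1), c ! i} = 0")
    case True
    then show ?thesis
      using scan_edge(1)[OF step.prems step.hyps(2)] step.hyps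
      by (intro exI[of _ 10] exI[of _ i]) auto
  next
    case False
    obtain r1 where r1: "(ram_step cut_program (n ^ 4) ^^ 12) (6, r, m) (6, r1, m)"
      "cut_registers n (Suc i) r1"
      using scan_edge(2)[OF step.prems step.hyps(2) False] by blast
    obtain t k r' where IH: "t \<le> 12 * (n - Suc i) + 2" "Suc i \<le> k" "k \<le> n"
      "k < n \<longrightarrow> w {c ! (k - 1), c ! k} = 0"
      "\<forall>l. Suc i \<le> l \<and> l < k \<longrightarrow> w {c ! (l - 1), c ! l} \<noteq> 0"
      "(ram_step cut_program (n ^ 4) ^^ t) (6, r1, m) (18, r', m)" "cut_registers n k r'"
      using step.IH[OF r1(2)] by auto
    have "(ram_step cut_program (n ^ 4) ^^ (12 + t)) (6, r, m) (18, r', m)"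
      using relpowp_ram_step_trans r1(1) IH(6) by blast
    moreover have "12 + t \<le> 12 * (n - i) + 2" using IH(1) step.hyps by simp
    moreover have "\<forall>l. i \<le> l \<and> l < k \<longrightarrow> w {c ! (l - 1), c ! l} \<noteq> 0"
      using IH(5) False by (metis Suc_leI le_neq_implies_less)
    ultimately show ?thesis
      using IH(2-4,7)
      by (intro exI[of _ "12 + t"] exI[of _ k] exI[of _ r']) (simp del: One_nat_def)
  qed
qed

text \<open>The address in the cycle is one past the cell copied last, so that position \<open>i\<close> ranges up to
  \<open>n\<close> and is only determined modulo \<open>n\<close>.\<close>

definition copy_state :: "nat \<Rightarrow> nat \<Rightarrow> (nat \<Rightarrow> nat) \<Rightarrow> (nat \<Rightarrow> nat) \<Rightarrow> bool" where
  "copy_state k j r m' \<longleftrightarrow>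
     (\<exists>i\<le>n. i mod n = (k + j) mod n \<and> cut_registers n i r) \<and> r 7 = j \<and> bounded_by (n ^ 4) m' \<and>
     (\<forall>i<j. m' i = rotate k c ! i) \<and> (\<forall>i<n. m' (Suc (n * n + i)) = c ! i)"

text \<open>Both branches take 10 steps: at the end of the cycle instruction 24 resets the address,
  elsewhere instruction 23 jumps over the reset.\<close>

lemma copy_cell:
  assumes "copy_state k j r m'" "j < n"
  shows "\<exists>r' m''. (ram_step cut_program (n ^ 4) ^^ 10) (19, r, m') (19, r', m'') \<and>
    copy_state k (Suc j) r' m''"
proof -
  obtain i where i: "i \<le> n" "i mod n = (k + j) mod n" "cut_registers n i r"
    and r7: "r 7 = j" and bm: "bounded_by (n ^ 4) m'"
    and out: "\<forall>i<j. m' i = rotate k c ! i" and cyc: "\<forall>i<n. m' (Suc (n * n + i)) = c ! i"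
    using assms(1) unfolding copy_state_def by blast
  \<comment> \<open>The position actually read: \<open>i = n\<close> wraps around to 0.\<close>
  define s where "s = i mod n"
  have s: "s < n" using n by (simp add: s_def)
  have "c ! s < n ^ 4" using nth_cycle_less[OF s] n by (intro address_bound) auto
  have *: "\<exists>r'. (ram_step cut_program (n ^ 4) ^^ 10) (19, r, m') (19, r', m'(j := c ! s)) \<and>
      cut_registers n (Suc s) r' \<and> r' 7 = Suc j"
  proof (cases "i = n")
    case True
    then have "s = 0" by (simp add: s_def)
    have "m' (Suc (n * n)) = c ! 0" using cyc s \<open>s = 0\<close> by fastforce
    show ?thesis
      using True \<open>s = 0\<close> \<open>m' (Suc (n * n)) = c ! 0\<close> i(3) r7 bm n assms(2) \<open>c ! s < n ^ 4\<close>
      by (simp add: run_simps address_bound)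
  next
    case False
    then have "s = i" using i(1) by (simp add: s_def)
    have "m' (Suc (n * n + i)) = c ! i" using cyc s \<open>s = i\<close> by blast
    show ?thesis
      using False \<open>s = i\<close> s \<open>m' (Suc (n * n + i)) = c ! i\<close> i(3) r7 bm n assms(2) \<open>c ! s < n ^ 4\<close>
      by (simp add: run_simps address_bound)
  qed
  have "rotate k c ! j = c ! s"
    using assms(2) i(2) length_cycle by (simp add: nth_rotate s_def)
  moreover have "Suc s mod n = (k + Suc j) mod n"
    using i(2) by (simp add: s_def mod_Suc_eq)
  \<comment> \<open>Output cells lie below address \<open>n\<close>, the cycle above
    \<open>n * n\<close>. Only cell 0, whose value register 2 keeps, and matrix entries are
    overwritten.\<close>
  moreover have "j \<noteq> Suc (n * n + l)" for l
    using assms(2) le_square[of n] by linarith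
  ultimately have "copy_state k (Suc j) r' (m'(j := c ! s))"
    if "cut_registers n (Suc s) r'" "r' 7 = Suc j" for r'
    unfolding copy_state_def using that s bm \<open>c ! s < n ^ 4\<close> out cyc
    by (auto simp: less_Suc_eq intro!: exI[of _ "Suc s"])
  then show ?thesis using * by blast
qed

lemma copy_run:
  assumes "copy_state k j r m'" "j \<le> n"
  shows "\<exists>t r' m''. t \<le> 10 * (n - j) + 2 \<and>
    (ram_step cut_program (n ^ 4) ^^ t) (19, r, m') (30, r', m'') \<and> (\<forall>i<n. m'' i = rotate k c ! i)"
  using assms(2,1)
proof (induction j arbitrary: r m' rule: inc_induct)
  case base
  then obtain i where "cut_registers n i r" "r 7 = n" "bounded_by (n ^ 4) m'"
    and "\<forall>i<n. m' i = rotate k c ! i"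
    unfolding copy_state_def by blast
  then have "\<exists>r'. (ram_step cut_program (n ^ 4) ^^ 2) (19, r, m') (30, r', m')"
    using n by (simp add: run_simps address_bound)
  then show ?case using \<open>\<forall>i<n. m' i = rotate k c ! i\<close> by (intro exI[of _ 2]) auto
next
  case (step j)
  obtain r1 m1 where 1:
    "(ram_step cut_program (n ^ 4) ^^ 10) (19, r, m') (19, r1, m1)" "copy_state k (Suc j) r1 m1"
    using copy_cell[OF step.prems step.hyps(2)] by blast
  obtain t' r2 m2 where 2: "t' \<le> 10 * (n - Suc j) + 2"
    "(ram_step cut_program (n ^ 4) ^^ t') (19, r1, m1) (30, r2, m2)"
    "\<forall>i<n. m2 i = rotate k c ! i"
    using step.IH[OF 1(2)] by blast
  have "10 + t' \<le> 10 * (n - j) + 2" using 2(1) step.hyps by simp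
  then show ?case using relpowp_ram_step_trans[OF 1(1) 2(2)] 2(3) by blast
qed

lemma cut_program_computes:
  "\<exists>k. 0 < k \<and> k \<le> n \<and> (k < n \<longrightarrow> w {c ! (k - 1), c ! k} = 0) \<and>
     (\<forall>l. 0 < l \<and> l < k \<longrightarrow> w {c ! (l - 1), c ! l} \<noteq> 0) \<and>
     ram_computes cut_program (n ^ 4) (22 * n + 11) (encode_instance n w c) (rotate k c)"
proof -
  obtain r1 where 1: "(ram_step cut_program (n ^ 4) ^^ 6) (0, \<lambda>_. 0, m) (6, r1, m)"
    "cut_registers n 1 r1"
    using setup_run by blast
  obtain t k r2 where 2: "t \<le> 12 * (n - 1) + 2" "1 \<le> k" "k \<le> n"
    "k < n \<longrightarrow> w {c ! (k - 1), c ! k} = 0" "\<forall>l. 1 \<le> l \<and> l < k \<longrightarrow> w {c ! (l - 1), c ! l} \<noteq> 0"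
    "(ram_step cut_program (n ^ 4) ^^ t) (6, r1, m) (18, r2, m)" "cut_registers n k r2"
    using scan_run[OF 1(2)] n by auto
  have 3: "(ram_step cut_program (n ^ 4) ^^ 1) (18, r2, m) (19, r2(7 := 0), m)"
    "cut_registers n k (r2(7 := 0))"
    using 2(7) bounded_by_memory n
    by (simp_all add: run_simps)
  \<comment> \<open>The scan has not changed the memory; copying starts at position
    \<open>k\<close>, possibly \<open>k = n\<close>.\<close>
  have "copy_state k 0 (r2(7 := 0)) m"
    unfolding copy_state_def using 3(2) 2(3) bounded_by_memory length_cycle
    by (auto simp: m_def instance_memory_cycle)
  from copy_run[OF this] obtain t' r' m' where 4: "t' \<le> 10 * n + 2"
    "(ram_step cut_program (n ^ 4) ^^ t') (19, r2(7 := 0), m) (30, r', m')"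
    "\<forall>i<n. m' i = rotate k c ! i"
    by auto
  have "(ram_step cut_program (n ^ 4) ^^ (6 + (t + (1 + t')))) (0, \<lambda>_. 0, m) (30, r', m')"
    by (rule relpowp_ram_step_trans[OF 1(1) relpowp_ram_step_trans[OF 2(6)
            relpowp_ram_step_trans[OF 3(1) 4(2)]]])
  moreover have "ram_init (encode_instance n w c) = (0, \<lambda>_. 0, m)"
    by (auto simp: ram_init_def m_def instance_memory_def)
  \<comment> \<open>Setup 6, scan at most \<open>12 * (n - 1) + 2\<close>, clearing register 7 one,
    copying at most \<open>10 * n + 2\<close>: at most \<open>22 * n - 1\<close> in all.\<close>
  moreover have "6 + (t + (1 + t')) \<le> 22 * n + 11" using 2(1) 4(1) n by simp
  moreover have "halted cut_program (30, r', m')" by (simp add: cut_program_def)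
  ultimately have
    "ram_computes cut_program (n ^ 4) (22 * n + 11) (encode_instance n w c) (rotate k c)"
    unfolding ram_computes_def using 4(3) length_cycle
    by (intro exI[of _ "6 + (t + (1 + t'))"] exI[of _ 30] exI[of _ r'] exI[of _ m']) simp
  then show ?thesis using 2 by (intro exI[of _ k]) auto
qed

end

section \<open>Linear-time computation of the approximate path\<close>

theorem theoremC4:
  fixes \<alpha> :: real
  assumes "0 < \<alpha>" and "\<alpha> \<le> 1"
  shows "\<exists>(P :: instr list) (T :: nat \<Rightarrow> nat) (d :: nat).
    (\<lambda>n. real (T n)) \<in> O(\<lambda>n. real n) \<and>
    (\<forall>(n :: nat) (w :: nat set \<Rightarrow> nat) (c :: nat list).
       zero_one_weighted {..<n} w \<and> max_tsp_approx \<alpha> {..<n} w c \<longrightarrow>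
       (\<exists>p. ram_computes P (n ^ d) (T n) (encode_instance n w c) p \<and>
            path_max_tsp_approx \<alpha> {..<n} w p))"
proof (rule exI[of _ cut_program], rule exI[of _ "\<lambda>n. 22 * n + 11"], rule exI[of _ 4],
    intro conjI allI impI)
  show "(\<lambda>n. real (22 * n + 11)) \<in> O(\<lambda>n. real n)"
    \<comment> \<open>\<open>22 * n + 11 \<le> 33 * n\<close> as soon as
      \<open>n \<ge> 1\<close>.\<close>
    by (rule bigoI[of _ 33]) (auto intro!: eventually_sequentiallyI[of 1])
next
  fix n :: nat and w c
  assume *: "zero_one_weighted {..<n} w \<and> max_tsp_approx \<alpha> {..<n} w c"
  then have c: "distinct c" "3 \<le> length c" "set c = {..<n}"
    by (auto simp: max_tsp_approx_def hamiltonian_cycle_complete)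
  have n: "length c = n" using c distinct_card by fastforce
  obtain k where k: "0 < k" "k \<le> n" "k < n \<longrightarrow> w {c ! (k - 1), c ! k} = 0"
     "\<forall>l. 0 < l \<and> l < k \<longrightarrow> w {c ! (l - 1), c ! l} \<noteq> 0"
     "ram_computes cut_program (n ^ 4) (22 * n + 11) (encode_instance n w c) (rotate k c)"
    using cut_program_computes[of n w c] * c n by auto
  have "path_max_tsp_approx \<alpha> {..<n} w (rotate k c)"
    using assms * k n by (intro path_max_tsp_approx_rotate) auto
  then show "\<exists>p. ram_computes cut_program (n ^ 4) (22 * n + 11) (encode_instance n w c) p \<and>
      path_max_tsp_approx \<alpha> {..<n} w p"
    using k(5) by blast
qed

end
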